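(* Let $z\in\mathbf H$ be written in the form $z=vI+s(wJ+xK+yL)$ with real $v,w,x,y$ and $s$ with $w^2+x^2+y^2\ne0$. Then $$\exp(z)=\exp(v)\left\{\cos(s\phi)I+i\,\frac{\sin(s\phi)}{\phi}\begin{pmatrix}w & y-ix \\ {y+ix} & -w\end{pmatrix}\right\},$$ where $\phi:=(w^2+x^2+y^2)^{1/2}$.
   Context: $\mathbf H$ is the quaternion skew field realized inside the $2\times2$ complex matrices with basis $I=\begin{pmatrix}1&0\\0&1\end{pmatrix}$, $J=\begin{pmatrix}i&0\\0&-i\end{pmatrix}$, $K=\begin{pmatrix}0&1\\-1&0\end{pmatrix}$, $L=\begin{pmatrix}0&i\\ i&0\end{pmatrix}$ over $\mathbf R$, $i=(-1)^{1/2}\in\mathbf C$. For $z\in\mathbf H$, $\exp(z):=\sum_{n=0}^\infty z^n/n!$. *)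

theory Defs
  imports "HOL-Analysis.Analysis"
begin

text \<open>Quaternions are realized as complex 2 x 2 matrices, i.e. elements of the type
  \<^typ>\<open>complex^2^2\<close>. The ring product is the matrix product \<open>**\<close>; the overloaded \<open>*\<close> and \<open>^\<close>
  on vectors are componentwise and must not be used here.\<close>

definition qI :: "complex^2^2" where
  "qI = vector [vector [1, 0], vector [0, 1]]"

definition qJ :: "complex^2^2" where
  "qJ = vector [vector [\<i>, 0], vector [0, - \<i>]]"

definition qK :: "complex^2^2" where
  "qK = vector [vector [0, 1], vector [- 1, 0]]"

definition qL :: "complex^2^2" where
  "qL = vector [vector [0, \<i>], vector [\<i>, 0]]"

definition quaternions :: "(complex^2^2) set" where
  "quaternions = span {qI, qJ, qK, qL}"

primrec mpow :: "complex^2^2 \<Rightarrow> nat \<Rightarrow> complex^2^2" where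
  "mpow z 0 = qI"
| "mpow z (Suc n) = z ** mpow z n"

definition qexp :: "complex^2^2 \<Rightarrow> complex^2^2" where
  "qexp z = (\<Sum>n. mpow z n /\<^sub>R fact n)"

definition cscale :: "complex \<Rightarrow> complex^2^2 \<Rightarrow> complex^2^2" where
  "cscale c A = (\<chi> i j. c * A $ i $ j)"

lemma qI_eq_mat_1: "qI = mat 1"
  by (simp add: qI_def vec_eq_iff mat_def forall_2)

text \<open>The exponential series converges, so that \<^const>\<open>suminf\<close> in \<open>qexp\<close> denotes its limit.\<close>

lemma mpow_entry_le:
  assumes M: "\<And>i j. norm (z $ i $ j) \<le> M"
  shows "norm (mpow z n $ i $ j) \<le> (2 * M) ^ n"
proof (induction n arbitrary: i j)
  case 0
  show ?case by (simp add: qI_eq_mat_1 mat_def)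
next
  case (Suc n)
  have M0: "0 \<le> M" using M[of 1 1] norm_ge_zero order_trans by blast
  have "norm (mpow z (Suc n) $ i $ j) \<le> (\<Sum>k\<in>UNIV. norm (z $ i $ k * mpow z n $ k $ j))"
    unfolding mpow.simps matrix_matrix_mult_def by (simp only: vec_lambda_beta) (rule norm_sum)
  also have "\<dots> \<le> (\<Sum>k\<in>(UNIV :: 2 set). M * (2 * M) ^ n)"
    unfolding norm_mult by (intro sum_mono mult_mono M Suc.IH M0 norm_ge_zero)
  also have "\<dots> = (2 * M) ^ Suc n" by simp
  finally show ?case .
qed

lemma qexp_summable: "summable (\<lambda>n. mpow z n /\<^sub>R fact n)"
proof -
  define M where "M = norm z"
  have M: "norm (z $ i $ j) \<le> M" for i j
    unfolding M_def by (meson Finite_Cartesian_Product.norm_nth_le order_trans)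
  have le: "norm (mpow z n) \<le> 4 * (2 * M) ^ n" for n
  proof -
    have "norm (mpow z n $ i) \<le> 2 * (2 * M) ^ n" for i
    proof -
      have "norm (mpow z n $ i) \<le> (\<Sum>j\<in>UNIV. norm (mpow z n $ i $ j))"
        unfolding norm_vec_def by (rule L2_set_le_sum) simp
      also have "\<dots> \<le> (\<Sum>j\<in>(UNIV :: 2 set). (2 * M) ^ n)"
        by (intro sum_mono mpow_entry_le M)
      finally show ?thesis by simp
    qed
    then have "(\<Sum>i\<in>UNIV. norm (mpow z n $ i)) \<le> (\<Sum>i\<in>(UNIV :: 2 set). 2 * (2 * M) ^ n)"
      by (intro sum_mono)
    moreover have "norm (mpow z n) \<le> (\<Sum>i\<in>UNIV. norm (mpow z n $ i))"
      unfolding norm_vec_def[of "mpow z n"] by (rule L2_set_le_sum) simp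
    ultimately show ?thesis by simp
  qed
  have "summable (\<lambda>n. 4 * ((2 * M) ^ n /\<^sub>R fact n))"
    by (intro summable_mult summable_exp_generic)
  then show ?thesis
  proof (rule summable_comparison_test')
    fix n :: nat
    show "norm (mpow z n /\<^sub>R fact n) \<le> 4 * ((2 * M) ^ n /\<^sub>R fact n)"
      using le[of n] by (simp add: field_simps)
  qed
qed

end

theory Submission
  imports Defs
begin

text \<open>If \<open>N ** N = - qI\<close>, then \<open>c \<mapsto> Re c *\<^sub>R qI + Im c *\<^sub>R N\<close> is a continuous algebra homomorphism
  from the complex numbers to the matrices, hence commutes with the exponential. Dividing
  the pure part \<open>w J + x K + y L\<close> by \<open>\<phi>\<close> gives such an \<open>N\<close>, and \<open>z\<close> is the image of \<open>v + i s \<phi>\<close>.\<close>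

definition complex_embed :: "complex^2^2 \<Rightarrow> complex \<Rightarrow> complex^2^2" where
  "complex_embed N c = Re c *\<^sub>R qI + Im c *\<^sub>R N"

lemma bounded_linear_complex_embed: "bounded_linear (complex_embed N)"
  unfolding complex_embed_def
  by (intro bounded_linear_add bounded_linear_scaleR_const bounded_linear_Re bounded_linear_Im)

lemma matrix_add_rdistrib: "(A + B) ** C = A ** C + B ** C"
  by (simp add: matrix_matrix_mult_def vec_eq_iff distrib_right sum.distrib)

lemma complex_embed_mult:
  assumes "N ** N = - qI"
  shows "complex_embed N (c * d) = complex_embed N c ** complex_embed N d"
proof -
  have "complex_embed N c ** complex_embed N d =
      (Re c * Re d) *\<^sub>R qI + (Re c * Im d) *\<^sub>R N + (Im c * Re d) *\<^sub>R N + (Im c * Im d) *\<^sub>R (N ** N)"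
    by (simp add: complex_embed_def qI_eq_mat_1 matrix_add_ldistrib matrix_add_rdistrib
        scalar_matrix_assoc [symmetric] matrix_scalar_ac
        algebra_simps)
  then show ?thesis
    by (simp add: assms complex_embed_def algebra_simps)
qed

lemma mpow_complex_embed:
  assumes "N ** N = - qI"
  shows "mpow (complex_embed N c) n = complex_embed N (c ^ n)"
proof (induction n)
  case 0
  show ?case by (simp add: complex_embed_def)
next
  case (Suc n)
  then show ?case by (simp add: complex_embed_mult [OF assms])
qed

text \<open>A bounded linear map may be applied termwise to the convergent series of
  \<open>exp c\<close>, and multiplicativity turns the image of each \<open>c ^ n\<close> into a
  matrix power.\<close>

lemma qexp_complex_embed:
  assumes "N ** N = - qI"
  shows "qexp (complex_embed N c) = complex_embed N (exp c)"
proof -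
  interpret bounded_linear "complex_embed N" by (rule bounded_linear_complex_embed)
  have "(\<lambda>n. complex_embed N (c ^ n /\<^sub>R fact n)) sums complex_embed N (exp c)"
    by (intro sums exp_converges)
  then show ?thesis
    by (simp add: qexp_def mpow_complex_embed [OF assms] scaleR sums_iff)
qed

text \<open>\<open>qJ\<close>, \<open>qK\<close> and \<open>qL\<close> square to \<open>- qI\<close>
  and anticommute pairwise, so the cross terms cancel; the proof verifies this entry by
  entry.\<close>

lemma pure_quaternion_square:
  fixes w x y :: real
  defines "P \<equiv> w *\<^sub>R qJ + x *\<^sub>R qK + y *\<^sub>R qL"
  shows "P ** P = - ((w\<^sup>2 + x\<^sup>2 + y\<^sup>2) *\<^sub>R qI)"
  by (simp add: P_def qI_def qJ_def qK_def qL_def vec_eq_iff matrix_matrix_mult_def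
      forall_2 sum_2 complex_eq_iff power2_eq_square)

theorem proposition3p2:
  fixes z :: "complex^2^2" and v w x y s \<phi> :: real
  assumes "z \<in> quaternions"
    and "z = v *\<^sub>R qI + s *\<^sub>R (w *\<^sub>R qJ + x *\<^sub>R qK + y *\<^sub>R qL)"
    and "w\<^sup>2 + x\<^sup>2 + y\<^sup>2 \<noteq> 0"
  defines "\<phi> \<equiv> sqrt (w\<^sup>2 + x\<^sup>2 + y\<^sup>2)"
  shows "qexp z = exp v *\<^sub>R (cos (s * \<phi>) *\<^sub>R qI +
           cscale (\<i> * complex_of_real (sin (s * \<phi>) / \<phi>))
             (vector [vector [complex_of_real w, complex_of_real y - \<i> * complex_of_real x],
                      vector [complex_of_real y + \<i> * complex_of_real x, - complex_of_real w]]))"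
proof -
  define P where "P = w *\<^sub>R qJ + x *\<^sub>R qK + y *\<^sub>R qL"
  define N where "N = (1 / \<phi>) *\<^sub>R P"
  have \<phi>: "\<phi> \<noteq> 0" "\<phi>\<^sup>2 = w\<^sup>2 + x\<^sup>2 + y\<^sup>2"
    using assms(3) by (simp_all add: \<phi>_def)
  have "P ** P = - (\<phi>\<^sup>2 *\<^sub>R qI)"
    unfolding P_def \<phi>(2) by (rule pure_quaternion_square)
  then have N: "N ** N = - qI"
    using \<phi>(1) by (simp add: N_def scalar_matrix_assoc [symmetric]
        matrix_scalar_ac power2_eq_square)
  \<comment> \<open>The imaginary part is \<open>s * \<phi>\<close> because \<open>P\<close> equals
    \<open>\<phi>\<close> times \<open>N\<close>.\<close>
  have "z = complex_embed N (Complex v (s * \<phi>))"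
    using \<phi>(1) by (simp add: assms(2) complex_embed_def N_def P_def)
  then have "qexp z = complex_embed N (exp (Complex v (s * \<phi>)))"
    by (simp only: qexp_complex_embed [OF N])
  \<comment> \<open>Euler's formula splits the complex exponential; the divisor
    \<open>\<phi>\<close> comes from rewriting \<open>N\<close> in terms of
    \<open>P\<close>.\<close>
  also have "\<dots> = exp v *\<^sub>R (cos (s * \<phi>) *\<^sub>R qI + (sin (s * \<phi>) / \<phi>) *\<^sub>R P)"
    by (simp add: complex_embed_def N_def Re_exp Im_exp algebra_simps)
  \<comment> \<open>Factoring \<i> out of \<open>P\<close>: its off-diagonal entries are x + \<i>y =
    \<i>(y - \<i>x) and -x + \<i>y = \<i>(y + \<i>x).\<close>
  also have "(sin (s * \<phi>) / \<phi>) *\<^sub>R P = cscale (\<i> * complex_of_real (sin (s * \<phi>) / \<phi>))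
      (vector [vector [complex_of_real w, complex_of_real y - \<i> * complex_of_real x],
               vector [complex_of_real y + \<i> * complex_of_real x, - complex_of_real w]])"
    by (simp add: P_def qJ_def qK_def qL_def cscale_def vec_eq_iff forall_2 complex_eq_iff
        algebra_simps)
  finally show ?thesis .
qed

end
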